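(* For countable structures, $\mathrm{II}=\mathrm{IA}$, $\mathrm{MI}=\mathrm{MA}$ and $\mathrm{HI}=\mathrm{HA}$. That is, for every countable structure $\mathcal{S}$ over a finite relational language: $\mathcal{S}$ is $\mathrm{II}$ if and only if $\mathcal{S}$ is $\mathrm{IA}$; $\mathcal{S}$ is $\mathrm{MI}$ if and only if $\mathcal{S}$ is $\mathrm{MA}$; and $\mathcal{S}$ is $\mathrm{HI}$ if and only if $\mathcal{S}$ is $\mathrm{HA}$.
   Context: Let $\mathcal{S}$ be a structure over a finite relational language. A homomorphism between structures is a map $f$ preserving all relations: $(a_1,\dots,a_n)\in R$ implies $(fa_1,\dots,fa_n)\in R$. A monomorphism is an injective homomorphism. An embedding is an injective homomorphism that also preserves the negations of all relations (an isomorphism onto its range). An automorphism of $\mathcal{S}$ is a surjective embedding $\mathcal{S}\to\mathcal{S}$. Finite partial maps: a finite partial endomorphism (symbol $\mathrm{H}$) of $\mathcal{S}$ is a homomorphism from a finite induced substructure of $\mathcal{S}$ to $\mathcal{S}$; a finite partial monomorphism (symbol $\mathrm{M}$) is an injective such map; a finite partial embedding (symbol $\mathrm{I}$) is an isomorphism between finite induced substructures of $\mathcal{S}$. For $X\in\{\mathrm{H},\mathrm{M},\mathrm{I}\}$, $\mathcal{S}$ is $X\mathrm{I}$ if every finite partial map of kind $X$ extends to an embedding $\mathcal{S}\to\mathcal{S}$ (not necessarily surjective), and $\mathcal{S}$ is $X\mathrm{A}$ if every finite partial map of kind $X$ extends to an automorphism of $\mathcal{S}$. *)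

theory Defs
  imports Main "HOL-Library.Countable_Set"
begin

record 'r language =
  symbols :: "'r set"
  arity :: "'r \<Rightarrow> nat"

text \<open>Structures live on an explicit universe inside a type; an n-tuple is a list of length n.
  The value of \<open>interp\<close> at a symbol outside the language is never used.\<close>

record ('a, 'r) rel_structure =
  universe :: "'a set"
  interp :: "'r \<Rightarrow> 'a list set"

definition finite_language :: "'r language \<Rightarrow> bool" where
  "finite_language L \<longleftrightarrow> finite (symbols L)"

definition tuples :: "'r language \<Rightarrow> ('a, 'r) rel_structure \<Rightarrow> 'r \<Rightarrow> 'a list set" where
  "tuples L S R = {xs. length xs = arity L R \<and> set xs \<subseteq> universe S}"

definition is_structure :: "'r language \<Rightarrow> ('a, 'r) rel_structure \<Rightarrow> bool" where
  "is_structure L S \<longleftrightarrow> (\<forall>R\<in>symbols L. interp S R \<subseteq> tuples L S R)"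

definition induced :: "('a, 'r) rel_structure \<Rightarrow> 'a set \<Rightarrow> ('a, 'r) rel_structure" where
  "induced S A = \<lparr>universe = A, interp = (\<lambda>R. {xs \<in> interp S R. set xs \<subseteq> A})\<rparr>"

text \<open>A map between structures is a HOL function considered only on the universe of its source.\<close>

definition homomorphism ::
    "'r language \<Rightarrow> ('a, 'r) rel_structure \<Rightarrow> ('b, 'r) rel_structure \<Rightarrow> ('a \<Rightarrow> 'b) \<Rightarrow> bool" where
  "homomorphism L S T f \<longleftrightarrow>
     f ` universe S \<subseteq> universe T \<and>
     (\<forall>R\<in>symbols L. \<forall>xs\<in>tuples L S R. xs \<in> interp S R \<longrightarrow> map f xs \<in> interp T R)"

definition monomorphism ::
    "'r language \<Rightarrow> ('a, 'r) rel_structure \<Rightarrow> ('b, 'r) rel_structure \<Rightarrow> ('a \<Rightarrow> 'b) \<Rightarrow> bool" where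
  "monomorphism L S T f \<longleftrightarrow> homomorphism L S T f \<and> inj_on f (universe S)"

definition embedding ::
    "'r language \<Rightarrow> ('a, 'r) rel_structure \<Rightarrow> ('b, 'r) rel_structure \<Rightarrow> ('a \<Rightarrow> 'b) \<Rightarrow> bool" where
  "embedding L S T f \<longleftrightarrow>
     homomorphism L S T f \<and> inj_on f (universe S) \<and>
     (\<forall>R\<in>symbols L. \<forall>xs\<in>tuples L S R. xs \<notin> interp S R \<longrightarrow> map f xs \<notin> interp T R)"

definition isomorphism ::
    "'r language \<Rightarrow> ('a, 'r) rel_structure \<Rightarrow> ('b, 'r) rel_structure \<Rightarrow> ('a \<Rightarrow> 'b) \<Rightarrow> bool" where
  "isomorphism L S T f \<longleftrightarrow> embedding L S T f \<and> f ` universe S = universe T"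

definition automorphism :: "'r language \<Rightarrow> ('a, 'r) rel_structure \<Rightarrow> ('a \<Rightarrow> 'a) \<Rightarrow> bool" where
  "automorphism L S f \<longleftrightarrow> isomorphism L S S f"

datatype partial_kind = Kind_H | Kind_M | Kind_I

text \<open>\<open>finite_partial_map X L S A f\<close>: the restriction of \<open>f\<close> to \<open>A\<close> is a finite partial map
  of \<open>S\<close> of kind \<open>X\<close> with domain \<open>A\<close>.\<close>

definition finite_partial_map ::
    "partial_kind \<Rightarrow> 'r language \<Rightarrow> ('a, 'r) rel_structure \<Rightarrow> 'a set \<Rightarrow> ('a \<Rightarrow> 'a) \<Rightarrow> bool" where
  "finite_partial_map X L S A f \<longleftrightarrow>
     finite A \<and> A \<subseteq> universe S \<and>
     (case X of
        Kind_H \<Rightarrow> homomorphism L (induced S A) S f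
      | Kind_M \<Rightarrow> monomorphism L (induced S A) S f
      | Kind_I \<Rightarrow> (\<exists>B. finite B \<and> B \<subseteq> universe S \<and>
                     isomorphism L (induced S A) (induced S B) f))"

definition homogeneous_I :: "partial_kind \<Rightarrow> 'r language \<Rightarrow> ('a, 'r) rel_structure \<Rightarrow> bool" where
  "homogeneous_I X L S \<longleftrightarrow>
     (\<forall>A f. finite_partial_map X L S A f \<longrightarrow>
        (\<exists>g. embedding L S S g \<and> (\<forall>x\<in>A. g x = f x)))"

definition homogeneous_A :: "partial_kind \<Rightarrow> 'r language \<Rightarrow> ('a, 'r) rel_structure \<Rightarrow> bool" where
  "homogeneous_A X L S \<longleftrightarrow>
     (\<forall>A f. finite_partial_map X L S A f \<longrightarrow>
        (\<exists>g. automorphism L S g \<and> (\<forall>x\<in>A. g x = f x)))"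

end

theory Submission
  imports Defs
begin

text \<open>If every partial map of kind X extends to an embedding, then partial maps of kind X are
  already partial isomorphisms, and conversely partial isomorphisms are of kind X; so everything
  reduces to II implies IA. There an extension to an embedding lets any point be added to the
  domain of a finite partial isomorphism, and, applied to the inverse map, any point be added to
  its range. Hence a back-and-forth along an enumeration of the countable universe yields an
  automorphism.\<close>

abbreviation partial_iso ::
    "'r language \<Rightarrow> ('a, 'r) rel_structure \<Rightarrow> 'a set \<Rightarrow> ('a \<Rightarrow> 'a) \<Rightarrow> bool" where
  "partial_iso \<equiv> finite_partial_map Kind_I"

lemma embedding_iff:
  "embedding L S T f \<longleftrightarrow> f ` universe S \<subseteq> universe T \<and> inj_on f (universe S) \<and>
     (\<forall>R\<in>symbols L. \<forall>xs\<in>tuples L S R. xs \<in> interp S R \<longleftrightarrow> map f xs \<in> interp T R)"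
  unfolding embedding_def homomorphism_def by blast

text \<open>Surjectivity forces \<open>B\<close> to be the image of \<open>A\<close> under
  \<open>f\<close>, which removes the existential; on tuples from \<open>A\<close> the induced
  relations are those of \<open>S\<close>.\<close>

lemma partial_iso_iff:
  "partial_iso L S A f \<longleftrightarrow>
     finite A \<and> A \<subseteq> universe S \<and> f ` A \<subseteq> universe S \<and> inj_on f A \<and>
     (\<forall>R\<in>symbols L. \<forall>xs. length xs = arity L R \<longrightarrow> set xs \<subseteq> A \<longrightarrow>
        (xs \<in> interp S R \<longleftrightarrow> map f xs \<in> interp S R))"
  (is "_ \<longleftrightarrow> ?P")
proof
  assume "partial_iso L S A f"
  then show ?P
    by (auto simp: finite_partial_map_def isomorphism_def embedding_iff induced_def tuples_def)
next
  assume P: ?P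
  then have "isomorphism L (induced S A) (induced S (f ` A)) f"
    by (auto simp: isomorphism_def embedding_iff induced_def tuples_def)
  with P show "partial_iso L S A f"
    by (auto simp: finite_partial_map_def)
qed

text \<open>Functions are total, so many of them represent the same partial map; this makes the
  choice of representative immaterial when a map is compared with its extensions.\<close>

lemma partial_iso_cong:
  assumes "partial_iso L S A f" and "\<And>x. x \<in> A \<Longrightarrow> g x = f x"
  shows "partial_iso L S A g"
proof -
  have "g ` A = f ` A" and "inj_on g A \<longleftrightarrow> inj_on f A"
    using assms(2) by (auto cong: inj_on_cong)
  moreover have "map g xs = map f xs" if "set xs \<subseteq> A" for xs
    using that assms(2) by auto
  ultimately show ?thesis
    using assms(1) unfolding partial_iso_iff by metis
qed

lemma partial_iso_embedding:
  assumes "embedding L S S g" "finite A" "A \<subseteq> universe S"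
  shows "partial_iso L S A g"
  using assms unfolding embedding_iff partial_iso_iff tuples_def
  by (auto intro: inj_on_subset)

lemma partial_iso_inverse:
  assumes "partial_iso L S A f"
  shows "partial_iso L S (f ` A) (inv_into A f)"
proof -
  have inj: "inj_on f A" using assms by (simp add: partial_iso_iff)
  have "ys \<in> interp S R \<longleftrightarrow> map (inv_into A f) ys \<in> interp S R"
    if "R \<in> symbols L" "length ys = arity L R" "set ys \<subseteq> f ` A" for R ys
  proof -
    \<comment> \<open>The equivalence for \<open>f\<close>, read at the pulled-back tuple inside
      \<open>A\<close>, is the one wanted for \<open>ys\<close>.\<close>
    have "map f (map (inv_into A f) ys) = ys"
      using that(3) by (auto intro!: map_idI simp: f_inv_into_f)
    moreover have "set (map (inv_into A f) ys) \<subseteq> A"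
      using that(3) by (auto intro: inv_into_into)
    ultimately show ?thesis
      using assms that(1,2) unfolding partial_iso_iff by (metis length_map)
  qed
  then show ?thesis
    using assms inj unfolding partial_iso_iff
    by (simp add: inj_on_inv_into)
qed

lemma partial_iso_kind:
  "partial_iso L S A f \<Longrightarrow> finite_partial_map X L S A f"
  by (cases X) (auto simp: finite_partial_map_def isomorphism_def embedding_def
      monomorphism_def homomorphism_def induced_def tuples_def)

text \<open>On \<open>A\<close> the map coincides with an embedding of \<open>S\<close>, and so
  inherits injectivity and the reflection of relations from it.\<close>

lemma homogeneous_I_imp_partial_iso:
  assumes "homogeneous_I X L S" and "finite_partial_map X L S A f"
  shows "partial_iso L S A f"
proof -
  obtain g where "embedding L S S g" "\<forall>x\<in>A. g x = f x"
    using assms unfolding homogeneous_I_def by blast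
  moreover have "finite A" "A \<subseteq> universe S"
    using assms(2) by (simp_all add: finite_partial_map_def)
  ultimately show ?thesis
    by (metis partial_iso_cong partial_iso_embedding)
qed

lemma partial_iso_forth:
  assumes "homogeneous_I Kind_I L S" "partial_iso L S A f" "x \<in> universe S"
  shows "\<exists>g. partial_iso L S (insert x A) g \<and> (\<forall>a\<in>A. g a = f a)"
proof -
  obtain g where "embedding L S S g" "\<forall>a\<in>A. g a = f a"
    using assms unfolding homogeneous_I_def by blast
  moreover have "finite (insert x A)" "insert x A \<subseteq> universe S"
    using assms(2,3) by (auto simp: partial_iso_iff)
  ultimately show ?thesis
    by (blast intro: partial_iso_embedding)
qed

text \<open>The inverse of \<open>f\<close> is extended to \<open>y\<close> and the result is
  inverted again. The preimage of \<open>y\<close> is whatever \<open>h\<close> assigns to it, hence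
  the unspecified domain \<open>B\<close>.\<close>

lemma partial_iso_back:
  assumes "homogeneous_I Kind_I L S" "partial_iso L S A f" "y \<in> universe S"
  shows "\<exists>B g. partial_iso L S B g \<and> A \<subseteq> B \<and> (\<forall>a\<in>A. g a = f a) \<and> y \<in> g ` B"
proof -
  obtain h where h: "partial_iso L S (insert y (f ` A)) h"
    and ext: "\<forall>b\<in>f ` A. h b = inv_into A f b"
    using partial_iso_forth[OF assms(1) partial_iso_inverse[OF assms(2)] assms(3)] by blast
  define C where "C = insert y (f ` A)"
  have inj_f: "inj_on f A" and inj_h: "inj_on h C"
    using assms(2) h by (simp_all add: partial_iso_iff C_def)
  \<comment> \<open>Since \<open>h\<close> extends the inverse of \<open>f\<close>, its own inverse
    extends \<open>f\<close>.\<close>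
  have hf: "h (f a) = a" if "a \<in> A" for a
    using that ext inj_f by simp
  have "partial_iso L S (h ` C) (inv_into C h)"
    using partial_iso_inverse h unfolding C_def .
  moreover have "A \<subseteq> h ` C"
    using hf unfolding C_def by force
  moreover have "inv_into C h a = f a" if "a \<in> A" for a
    using that hf inv_into_f_f[OF inj_h, of "f a"] by (simp add: C_def)
  moreover have "y \<in> inv_into C h ` h ` C"
    using inj_h by (simp add: C_def)
  ultimately show ?thesis by blast
qed

lemma partial_iso_back_and_forth:
  assumes "homogeneous_I Kind_I L S" "partial_iso L S A f" "x \<in> universe S"
  shows "\<exists>B g. partial_iso L S B g \<and> A \<subseteq> B \<and> (\<forall>a\<in>A. g a = f a) \<and> x \<in> B \<and> x \<in> g ` B"
proof -
  obtain g where g: "partial_iso L S (insert x A) g" "\<forall>a\<in>A. g a = f a"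
    using partial_iso_forth[OF assms] by blast
  obtain B h where "partial_iso L S B h" "insert x A \<subseteq> B" "\<forall>a\<in>insert x A. h a = g a" "x \<in> h ` B"
    using partial_iso_back[OF assms(1) g(1) assms(3)] by blast
  with g(2) show ?thesis by (metis insert_subset insertCI)
qed

text \<open>Injectivity and the preservation and reflection of a relation are tested on finitely
  many points at a time, and in an increasing chain these all lie in one \<open>B n\<close>, where
  the limit map is \<open>g n\<close>.\<close>

lemma partial_iso_chain_union:
  fixes B :: "nat \<Rightarrow> 'a set" and g :: "nat \<Rightarrow> 'a \<Rightarrow> 'a"
  assumes iso: "\<And>n. partial_iso L S (B n) (g n)"
    and sub: "\<And>n. B n \<subseteq> B (Suc n)"
    and agree: "\<And>n a. a \<in> B n \<Longrightarrow> g (Suc n) a = g n a"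
    and dom: "universe S \<subseteq> (\<Union>n. B n)"
    and ran: "universe S \<subseteq> (\<Union>n. g n ` B n)"
  shows "\<exists>h. automorphism L S h \<and> (\<forall>n. \<forall>a\<in>B n. h a = g n a)"
proof -
  have mono: "B m \<subseteq> B n" if "m \<le> n" for m n
    using that sub by (rule lift_Suc_mono_le[rotated])
  have agree_le: "g n a = g m a" if "m \<le> n" "a \<in> B m" for m n a
    using that(1)
  proof (induction n rule: dec_induct)
    case (step n)
    then show ?case using agree mono[of m n] that(2) by auto
  qed simp
  \<comment> \<open>The value is taken at the first stage containing \<open>a\<close>; by
    \<open>agree_le\<close> every later stage gives the same one.\<close>
  define h where "h a = g (LEAST n. a \<in> B n) a" for a
  have h: "h a = g n a" if "a \<in> B n" for n a
    unfolding h_def using that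
    by (metis (mono_tags, lifting) LeastI Least_le agree_le)
  have fin: "\<exists>n. F \<subseteq> B n" if "finite F" "F \<subseteq> universe S" for F
    using that
  proof (induction F rule: finite_induct)
    case (insert x F)
    then obtain m n where "F \<subseteq> B m" "x \<in> B n"
      using dom by auto
    then have "insert x F \<subseteq> B (max m n)"
      using mono[of m "max m n"] mono[of n "max m n"] by auto
    then show ?case by blast
  qed simp
  have isoh: "partial_iso L S (B n) h" for n
    using iso h by (rule partial_iso_cong)
  have loc: "\<exists>n. set xs \<subseteq> B n" if "set xs \<subseteq> universe S" for xs
    using fin that by blast
  have "inj_on h (universe S)"
  proof (rule inj_onI)
    fix x y assume "x \<in> universe S" "y \<in> universe S" "h x = h y"
    \<comment> \<open>The two points are treated as a tuple to find a common stage.\<close>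
    moreover obtain n where "set [x, y] \<subseteq> B n"
      using loc[of "[x, y]"] calculation by auto
    ultimately show "x = y"
      using isoh[of n] by (auto simp: partial_iso_iff inj_on_def)
  qed
  moreover have "h ` universe S \<subseteq> universe S"
    using dom isoh unfolding partial_iso_iff by blast
  moreover have "universe S \<subseteq> h ` universe S"
  proof
    fix y assume "y \<in> universe S"
    then obtain n a where "a \<in> B n" "y = g n a" using ran by blast
    then show "y \<in> h ` universe S"
      using h iso[of n] unfolding partial_iso_iff by (metis imageI subsetD)
  qed
  moreover have "xs \<in> interp S R \<longleftrightarrow> map h xs \<in> interp S R"
    if R: "R \<in> symbols L" and xs: "xs \<in> tuples L S R" for R xs
  proof -
    have "set xs \<subseteq> universe S" using xs by (simp add: tuples_def)
    then obtain n where "set xs \<subseteq> B n" using loc by blast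
    moreover have "length xs = arity L R" using xs by (simp add: tuples_def)
    ultimately show ?thesis
      using isoh[of n] R by (simp add: partial_iso_iff)
  qed
  ultimately have "automorphism L S h"
    unfolding automorphism_def isomorphism_def embedding_iff by blast
  with h show ?thesis by blast
qed

lemma homogeneous_II_imp_IA:
  fixes S :: "('a, 'r) rel_structure"
  assumes hom: "homogeneous_I Kind_I L S" and countable: "countable (universe S)"
  shows "homogeneous_A Kind_I L S"
  unfolding homogeneous_A_def
proof (intro allI impI)
  fix A f assume f: "partial_iso L S A f"
  show "\<exists>g. automorphism L S g \<and> (\<forall>x\<in>A. g x = f x)"
  proof (cases "universe S = {}")
    \<comment> \<open>An empty set has no enumeration by the naturals; here any embedding is
      trivially onto.\<close>
    case True
    then show ?thesis
      using hom f unfolding homogeneous_I_def automorphism_def isomorphism_def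
      by (metis image_empty)
  next
    case False
    \<comment> \<open>Repetitions in the enumeration are harmless, so finite universes are covered
      too.\<close>
    define e where "e = from_nat_into (universe S)"
    have e: "range e = universe S"
      unfolding e_def using False countable by (rule range_from_nat_into)
    \<comment> \<open>A stage is a pair of a domain and a map. The clause for \<open>n = 0\<close>
      makes the chain start at the given map; \<open>Q\<close> below demands that passing from stage
      \<open>n\<close> to \<open>Suc n\<close> puts \<open>e n\<close> into both domain and
      range.\<close>
    define P where "P n p \<longleftrightarrow> partial_iso L S (fst p) (snd p) \<and> (n = 0 \<longrightarrow> p = (A, f))"
      for n :: nat and p :: "'a set \<times> ('a \<Rightarrow> 'a)"
    define Q where "Q n p q \<longleftrightarrow> fst p \<subseteq> fst q \<and> (\<forall>a\<in>fst p. snd q a = snd p a) \<and>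
        e n \<in> fst q \<and> e n \<in> snd q ` fst q"
      for n and p q :: "'a set \<times> ('a \<Rightarrow> 'a)"
    have "\<exists>s. \<forall>n. P n (s n) \<and> Q n (s n) (s (Suc n))"
    proof (rule dependent_nat_choice)
      show "\<exists>p. P 0 p" using f by (simp add: P_def)
      fix p n assume "P n p"
      then have p: "partial_iso L S (fst p) (snd p)" by (simp add: P_def)
      have "e n \<in> universe S" using rangeI[of e n] unfolding e .
      from partial_iso_back_and_forth[OF hom p this]
      obtain B g where "partial_iso L S B g \<and> fst p \<subseteq> B \<and> (\<forall>a\<in>fst p. g a = snd p a) \<and>
          e n \<in> B \<and> e n \<in> g ` B"
        by (elim exE)
      then have "P (Suc n) (B, g) \<and> Q n p (B, g)"
        by (simp add: P_def Q_def)
      then show "\<exists>q. P (Suc n) q \<and> Q n p q" ..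
    qed
    then obtain s where s: "\<And>n. P n (s n)" "\<And>n. Q n (s n) (s (Suc n))" by blast
    have "\<exists>h. automorphism L S h \<and> (\<forall>n. \<forall>a\<in>fst (s n). h a = snd (s n) a)"
    proof (rule partial_iso_chain_union)
      fix n
      show "partial_iso L S (fst (s n)) (snd (s n))"
        using s(1) by (simp add: P_def)
      show "fst (s n) \<subseteq> fst (s (Suc n))"
        using s(2) by (simp add: Q_def)
      show "snd (s (Suc n)) a = snd (s n) a" if "a \<in> fst (s n)" for a
        using s(2) that by (simp add: Q_def)
    next
      \<comment> \<open>The point \<open>e n\<close> is guaranteed only from stage
        \<open>Suc n\<close> on.\<close>
      show "universe S \<subseteq> (\<Union>n. fst (s n))" "universe S \<subseteq> (\<Union>n. snd (s n) ` fst (s n))"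
        using s(2) unfolding e[symmetric] Q_def by blast+
    qed
    moreover have "s 0 = (A, f)" using s(1)[of 0] by (simp add: P_def)
    ultimately show ?thesis by (metis fst_conv snd_conv)
  qed
qed

lemma homogeneous_A_imp_I: "homogeneous_A X L S \<Longrightarrow> homogeneous_I X L S"
  unfolding homogeneous_A_def homogeneous_I_def automorphism_def isomorphism_def by blast

lemma homogeneous_I_iff_A:
  assumes "countable (universe S)"
  shows "homogeneous_I X L S \<longleftrightarrow> homogeneous_A X L S"
proof
  assume X: "homogeneous_I X L S"
  then have "homogeneous_I Kind_I L S"
    unfolding homogeneous_I_def by (blast intro: partial_iso_kind)
  then have "homogeneous_A Kind_I L S"
    using assms by (rule homogeneous_II_imp_IA)
  \<comment> \<open>Under the assumption on \<open>X\<close>, a map of kind \<open>X\<close> is a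
    partial isomorphism, so the automorphism extending it comes from the case of
    \<open>Kind_I\<close>.\<close>
  then show "homogeneous_A X L S"
    unfolding homogeneous_A_def using homogeneous_I_imp_partial_iso[OF X] by blast
qed (rule homogeneous_A_imp_I)

theorem lemma1p1:
  fixes L :: "'r language" and S :: "('a, 'r) rel_structure"
  assumes "finite_language L"
    and "is_structure L S"
    and "countable (universe S)"
  shows "(homogeneous_I Kind_I L S \<longleftrightarrow> homogeneous_A Kind_I L S) \<and>
         (homogeneous_I Kind_M L S \<longleftrightarrow> homogeneous_A Kind_M L S) \<and>
         (homogeneous_I Kind_H L S \<longleftrightarrow> homogeneous_A Kind_H L S)"
  using homogeneous_I_iff_A[OF assms(3)] by blast

end
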